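(* Let $(M,\nabla_M)$ be a $3$-dimensional compact affine manifold, and suppose that $S_M$ is not trivial, i.e. $S_M\neq 0$. Then either $(M,\nabla_M)$ is radiant or there exists a codimension $1$ linear foliation defined on $(M,\nabla_M)$.
   Context: All manifolds are connected and without boundary. An $n$-dimensional affine manifold $(M,\nabla_M)$ is a smooth $n$-manifold $M$ with a flat torsion-free connection $\nabla_M$ (equivalently, an atlas whose coordinate changes are affine transformations of $\mathbb{R}^n$). Let $p_M:\hat M\to M$ be the universal cover with the pulled-back connection $\nabla_{\hat M}$, $D_M:\hat M\to\mathbb{R}^n$ the developing map (an affine local diffeomorphism), and $Aff(\hat M,\nabla_{\hat M})$ the group of diffeomorphisms of $\hat M$ preserving $\nabla_{\hat M}$. There is a representation $H_M:Aff(\hat M,\nabla_{\hat M})\to Aff(\mathbb{R}^n)$ with $D_M\circ g=H_M(g)\circ D_M$; the holonomy $h_M$ is its restriction to $\pi_1(M)$, acting by deck transformations, and $L(h_M)$ is the linear part of $h_M$. $(M,\nabla_M)$ is radiant if $h_M(\pi_1(M))$ fixes an element of $\mathbb{R}^n$. Let $N(\pi_1(M))$ be the normalizer of $\pi_1(M)$ in $Aff(\hat M,\nabla_{\hat M})$ and $n(\pi_1(M))$ its Lie algebra. Let $Lie(H_M)$ be the Lie algebra morphism induced by $H_M$. The image $Lie(H_M)(n(\pi_1(M)))\subset aff(\mathbb{R}^n)$ is stable under the associative product $(A,a).(B,b)=(AB,A(b))$ of $aff(\mathbb{R}^n)$ (where $(A,a)$ has linear part $A$ and translational part $a$). Hence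 it decomposes as $S_M\oplus N_M$, where $S_M$ is a semi-simple associative algebra and $N_M$ is a nilpotent associative algebra (the Wedderburn decomposition; $N_M$ is the nilpotent radical). If $U\subset\mathbb{R}^n$ is a vector subspace with $L(h_M)(\gamma)(U)=U$ for all $\gamma\in\pi_1(M)$, the foliation of $\mathbb{R}^n$ by affine subspaces parallel to $U$ pulls back under $D_M$ to a $\pi_1(M)$-invariant foliation ${\cal F}^U_{\hat M}$ of $\hat M$, which is the pullback by $p_M$ of a foliation ${\cal F}^U_M$ of $M$; ${\cal F}^U_M$ is called a linear foliation. Its codimension is $n-\dim U$. *)

theory Defs
  imports "HOL-Analysis.Analysis" "HOL-Algebra.Group_Action"
begin

section \<open>Affine maps of $R^n$\<close>

text \<open>The pair \<open>(A, a)\<close> stands for the map \<open>x \<mapsto> A x + a\<close>.  The same pairs represent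
  the group of affine transformations (when \<open>A\<close> is invertible) and its Lie algebra.\<close>

type_synonym 'n aff = "(real^'n^'n) \<times> (real^'n)"

definition aff_apply :: "'n::finite aff \<Rightarrow> real^'n \<Rightarrow> real^'n" where
  "aff_apply T x = fst T *v x + snd T"

definition Aff :: "'n::finite aff set" where
  "Aff = {T. invertible (fst T)}"

text \<open>The associative product on the Lie algebra.  It is not the composition of affine maps,
  and it has no two-sided unit.\<close>

definition aff_mult :: "'n::finite aff \<Rightarrow> 'n aff \<Rightarrow> 'n aff" where
  "aff_mult S T = (fst S ** fst T, fst S *v snd T)"


section \<open>Affine manifolds and their affine transformations\<close>

type_synonym ('m, 'n) atlas = "('m set \<times> ('m \<Rightarrow> real^'n)) set"

text \<open>\<open>g = T \<circ> f\<close> near \<open>x\<close> for some affine transformation \<open>T\<close>.\<close>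

definition aff_related_at ::
  "'m::topological_space set \<Rightarrow> 'm \<Rightarrow> ('m \<Rightarrow> real^'n::finite) \<Rightarrow> ('m \<Rightarrow> real^'n) \<Rightarrow> bool" where
  "aff_related_at M x f g \<longleftrightarrow>
     (\<exists>W. \<exists>T\<in>Aff. openin (top_of_set M) W \<and> x \<in> W \<and> (\<forall>y\<in>W. g y = aff_apply T (f y)))"

text \<open>Coordinate changes are only required to be locally affine, because the overlap of two
  charts may be disconnected.\<close>

definition affine_manifold ::
  "'m::topological_space set \<Rightarrow> ('m, 'n::finite) atlas \<Rightarrow> bool" where
  "affine_manifold M \<A> \<longleftrightarrow>
     M \<noteq> {} \<and> connected M \<and>
     Hausdorff_space (top_of_set M) \<and> second_countable (top_of_set M) \<and>
     (\<Union>(U, \<phi>)\<in>\<A>. U) = M \<and>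
     (\<forall>(U, \<phi>)\<in>\<A>. openin (top_of_set M) U \<and> open (\<phi> ` U) \<and>
        (\<exists>\<psi>. homeomorphism U (\<phi> ` U) \<phi> \<psi>)) \<and>
     (\<forall>(U, \<phi>)\<in>\<A>. \<forall>(V, \<psi>)\<in>\<A>. \<forall>x\<in>U \<inter> V. aff_related_at M x \<phi> \<psi>)"

definition affine_local_diffeo ::
  "'m::topological_space set \<Rightarrow> ('m, 'n::finite) atlas \<Rightarrow>
   'k::topological_space set \<Rightarrow> ('k, 'n) atlas \<Rightarrow> ('m \<Rightarrow> 'k) \<Rightarrow> bool" where
  "affine_local_diffeo M \<A> N \<B> f \<longleftrightarrow>
     continuous_on M f \<and> f ` M \<subseteq> N \<and>
     (\<forall>(U, \<phi>)\<in>\<A>. \<forall>(V, \<psi>)\<in>\<B>. \<forall>x\<in>M. x \<in> U \<and> f x \<in> V \<longrightarrow>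
        aff_related_at M x \<phi> (\<lambda>y. \<psi> (f y)))"

text \<open>The elements of \<^const>\<open>Bij\<close> are extensional functions, so that the library's group of
  bijections of a set can be used.\<close>

definition affine_diffeos ::
  "'c::topological_space set \<Rightarrow> ('c, 'n::finite) atlas \<Rightarrow> ('c \<Rightarrow> 'c) set" where
  "affine_diffeos C \<A> =
     {g \<in> Bij C. (\<exists>h. homeomorphism C C g h) \<and> affine_local_diffeo C \<A> C \<A> g}"

definition affine_group ::
  "'c::topological_space set \<Rightarrow> ('c, 'n::finite) atlas \<Rightarrow> ('c \<Rightarrow> 'c) monoid" where
  "affine_group C \<A> = (BijGroup C)\<lparr>carrier := affine_diffeos C \<A>\<rparr>"


section \<open>Universal cover, developing map and holonomy\<close>

definition universal_cover ::
  "'c::topological_space set \<Rightarrow> ('c \<Rightarrow> 'm) \<Rightarrow> 'm::topological_space set \<Rightarrow> bool" where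
  "universal_cover C p M \<longleftrightarrow> covering_space C p M \<and> simply_connected C"

text \<open>The fundamental group of the base, acting on the universal cover.\<close>

definition deck_transformations ::
  "'c::topological_space set \<Rightarrow> ('c \<Rightarrow> 'm) \<Rightarrow> ('c \<Rightarrow> 'c) set" where
  "deck_transformations C p =
     {g \<in> Bij C. (\<exists>h. homeomorphism C C g h) \<and> (\<forall>x\<in>C. p (g x) = p x)}"

text \<open>The atlas of the pulled-back connection on the total space of a covering \<open>p\<close> of \<open>M\<close>.\<close>

definition pullback_atlas ::
  "'c::topological_space set \<Rightarrow> ('c \<Rightarrow> 'm) \<Rightarrow> 'm::topological_space set \<Rightarrow>
   ('m, 'n::finite) atlas \<Rightarrow> ('c, 'n) atlas" where
  "pullback_atlas C p M \<A> =
     {(W, \<phi> \<circ> p) | W U \<phi>. (U, \<phi>) \<in> \<A> \<and> openin (top_of_set C) W \<and> p ` W \<subseteq> U \<and>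
        openin (top_of_set M) (p ` W) \<and> (\<exists>q. homeomorphism W (p ` W) p q)}"

definition developing_map ::
  "'c::topological_space set \<Rightarrow> ('c, 'n::finite) atlas \<Rightarrow> ('c \<Rightarrow> real^'n) \<Rightarrow> bool" where
  "developing_map C \<A> D \<longleftrightarrow> affine_local_diffeo C \<A> UNIV {(UNIV, \<lambda>x. x)} D"

text \<open>The representation \<open>H_M\<close> of the affine group of the universal cover; its restriction to
  the deck transformations is the holonomy.\<close>

definition aff_rep ::
  "'c set \<Rightarrow> ('c \<Rightarrow> real^'n::finite) \<Rightarrow> ('c \<Rightarrow> 'c) \<Rightarrow> 'n aff" where
  "aff_rep C D g = (THE T. T \<in> Aff \<and> (\<forall>x\<in>C. D (g x) = aff_apply T (D x)))"

definition radiant ::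
  "'c::topological_space set \<Rightarrow> ('c \<Rightarrow> 'm) \<Rightarrow> ('c \<Rightarrow> real^'n::finite) \<Rightarrow> bool" where
  "radiant C p D \<longleftrightarrow>
     (\<exists>v. \<forall>\<gamma>\<in>deck_transformations C p. aff_apply (aff_rep C D \<gamma>) v = v)"


section \<open>The Lie algebra of the normalizer and its image\<close>

text \<open>An element \<open>X\<close> of the Lie algebra of a Lie group \<open>G\<close> of transformations of \<open>C\<close> is
  represented by its one-parameter subgroup \<open>t \<mapsto> exp (t X)\<close>.  Joint continuity in \<open>(t, x)\<close> is
  continuity in \<open>t\<close> for the compact-open topology, which is the topology of the group of
  affine diffeomorphisms; continuous one-parameter subgroups of a Lie group are smooth.\<close>

definition lie_algebra ::
  "'c::topological_space set \<Rightarrow> ('c \<Rightarrow> 'c) set \<Rightarrow> (real \<Rightarrow> 'c \<Rightarrow> 'c) set" where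
  "lie_algebra C G =
     {\<theta>. (\<forall>t. \<theta> t \<in> G) \<and> (\<forall>s t. \<theta> (s + t) = \<theta> s \<otimes>\<^bsub>BijGroup C\<^esub> \<theta> t) \<and>
         continuous_on (UNIV \<times> C) (\<lambda>(t, x). \<theta> t x)}"

text \<open>The image under \<open>Lie(H_M)\<close> of the Lie algebra of \<open>G\<close>: the morphism sends a
  one-parameter subgroup \<open>\<theta>\<close> to the velocity of \<open>H_M \<circ> \<theta>\<close> at \<open>0\<close>.\<close>

definition lie_rep_image ::
  "'c::topological_space set \<Rightarrow> ('c \<Rightarrow> real^'n::finite) \<Rightarrow> ('c \<Rightarrow> 'c) set \<Rightarrow> 'n aff set" where
  "lie_rep_image C D G =
     {X. \<exists>\<theta>\<in>lie_algebra C G. ((\<lambda>t. aff_rep C D (\<theta> t)) has_vector_derivative X) (at 0)}"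

definition normalizer_lie_image ::
  "'m::topological_space set \<Rightarrow> ('m, 'n::finite) atlas \<Rightarrow> 'c::topological_space set \<Rightarrow>
   ('c \<Rightarrow> 'm) \<Rightarrow> ('c \<Rightarrow> real^'n) \<Rightarrow> 'n aff set" where
  "normalizer_lie_image M \<A> C p D =
     lie_rep_image C D
       (normalizer (affine_group C (pullback_atlas C p M \<A>)) (deck_transformations C p))"


section \<open>Wedderburn decomposition of associative algebras of affine maps\<close>

definition aff_subalgebra :: "'n::finite aff set \<Rightarrow> bool" where
  "aff_subalgebra A \<longleftrightarrow> subspace A \<and> (\<forall>x\<in>A. \<forall>y\<in>A. aff_mult x y \<in> A)"

definition aff_ideal :: "'n::finite aff set \<Rightarrow> 'n aff set \<Rightarrow> bool" where
  "aff_ideal I A \<longleftrightarrow> subspace I \<and> I \<subseteq> A \<and>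
     (\<forall>x\<in>A. \<forall>y\<in>I. aff_mult x y \<in> I \<and> aff_mult y x \<in> I)"

text \<open>All products of some fixed number \<open>k + 1\<close> of elements vanish.\<close>

definition aff_nilpotent :: "'n::finite aff set \<Rightarrow> bool" where
  "aff_nilpotent I \<longleftrightarrow>
     (\<exists>k. \<forall>x\<in>I. \<forall>xs. set xs \<subseteq> I \<and> length xs = k \<longrightarrow> foldl aff_mult x xs = 0)"

definition aff_semisimple :: "'n::finite aff set \<Rightarrow> bool" where
  "aff_semisimple S \<longleftrightarrow> aff_subalgebra S \<and>
     (\<forall>I. aff_ideal I S \<and> aff_nilpotent I \<longrightarrow> I = {0})"

definition nilpotent_radical :: "'n::finite aff set \<Rightarrow> 'n aff set \<Rightarrow> bool" where
  "nilpotent_radical N A \<longleftrightarrow> aff_ideal N A \<and> aff_nilpotent N \<and>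
     (\<forall>I. aff_ideal I A \<and> aff_nilpotent I \<longrightarrow> I \<subseteq> N)"

definition wedderburn_decomposition ::
  "'n::finite aff set \<Rightarrow> 'n aff set \<Rightarrow> 'n aff set \<Rightarrow> bool" where
  "wedderburn_decomposition A S N \<longleftrightarrow>
     aff_subalgebra A \<and> aff_semisimple S \<and> nilpotent_radical N A \<and>
     A = {s + n | s n. s \<in> S \<and> n \<in> N} \<and> S \<inter> N = {0}"


section \<open>Linear foliations\<close>

definition holonomy_invariant ::
  "'c::topological_space set \<Rightarrow> ('c \<Rightarrow> 'm) \<Rightarrow> ('c \<Rightarrow> real^'n::finite) \<Rightarrow> (real^'n) set \<Rightarrow> bool" where
  "holonomy_invariant C p D U \<longleftrightarrow>
     (\<forall>\<gamma>\<in>deck_transformations C p. (\<lambda>u. fst (aff_rep C D \<gamma>) *v u) ` U = U)"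

text \<open>Foliations are given by their sets of leaves.  The leaves of the pullback under the local
  diffeomorphism \<open>D\<close> of the foliation by the closed affine subspaces \<open>v + U\<close> are the connected
  components of their preimages.\<close>

definition cover_leaves ::
  "'c::topological_space set \<Rightarrow> ('c \<Rightarrow> real^'n::finite) \<Rightarrow> (real^'n) set \<Rightarrow> 'c set set" where
  "cover_leaves C D U = (\<Union>v. components {x \<in> C. D x \<in> (+) v ` U})"

text \<open>A foliation pulls back under the covering \<open>p\<close> to the foliation with leaves
  \<^term>\<open>cover_leaves C D U\<close> precisely when its leaves are the images of those under \<open>p\<close>.\<close>

definition linear_foliation ::
  "'c::topological_space set \<Rightarrow> ('c \<Rightarrow> 'm) \<Rightarrow> ('c \<Rightarrow> real^'n::finite) \<Rightarrow> nat \<Rightarrow> 'm set set \<Rightarrow> bool"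
  where
  "linear_foliation C p D k \<F> \<longleftrightarrow>
     (\<exists>U. subspace U \<and> holonomy_invariant C p D U \<and> dim U + k = CARD('n) \<and>
          \<F> = (`) p ` cover_leaves C D U)"

end

theory Submission
  imports Defs
begin

text \<open>
  A one-parameter subgroup of the normalizer conjugates each deck transformation into a curve
  in the discrete deck group, hence commutes with it.  Therefore every element
  \<open>X = (B, b)\<close> of the image of the normalizer's Lie algebra is an affine vector field that is
  invariant under the holonomy, and \<open>B\<close> commutes with the linear holonomy.  Since \<open>S\<^sub>M\<close> is
  semisimple and nonzero, it contains such an \<open>X\<close> with \<open>B \<noteq> 0\<close>.  If \<open>B\<close> has rank 3, the
  unique zero of \<open>X\<close> is fixed by the holonomy; if \<open>B\<close> has rank 2 or 1, its range or
  its kernel is a plane invariant under the linear holonomy.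
\<close>

section \<open>Germs of affine maps\<close>

text \<open>Differences of values at two points of a ball see only the linear part, and by scaling
  every direction can be realised inside the ball. The translation part is then read off at the
  centre.\<close>

lemma aff_apply_inject_open:
  fixes S T :: "'n::finite aff"
  assumes "open Q" "Q \<noteq> {}" and eq: "\<And>q. q \<in> Q \<Longrightarrow> aff_apply S q = aff_apply T q"
  shows "S = T"
proof -
  obtain q e where e: "e > 0" "ball q e \<subseteq> Q"
    using assms(1,2) open_contains_ball by blast
  then have q: "q \<in> Q" by auto
  have lin: "fst S *v v = fst T *v v" for v
  proof (cases "v = 0")
    case False
    \<comment> \<open>The factor 2 makes the displaced point lie strictly inside the open ball of
      radius \<open>e\<close>.\<close>
    define c where "c = e / (2 * norm v)"
    have c: "c \<noteq> 0" "norm (c *\<^sub>R v) < e"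
      using e False by (auto simp: c_def)
    then have "q + c *\<^sub>R v \<in> Q"
      using e by (auto simp: subset_iff dist_norm)
    then have "aff_apply S (q + c *\<^sub>R v) - aff_apply S q = aff_apply T (q + c *\<^sub>R v) - aff_apply T q"
      using eq q by simp
    then have "c *\<^sub>R (fst S *v v) = c *\<^sub>R (fst T *v v)"
      by (simp add: aff_apply_def matrix_vector_right_distrib matrix_vector_mult_scaleR)
    then show ?thesis using c by simp
  qed auto
  then have "fst S = fst T" by (simp add: matrix_eq)
  moreover have "snd S = snd T"
    using eq[OF q] lin by (simp add: aff_apply_def)
  ultimately show ?thesis by (simp add: prod_eq_iff)
qed

lemma Aff_compose:
  assumes "S \<in> Aff" "T \<in> Aff"
  obtains R where "R \<in> Aff" "\<And>x. aff_apply R x = aff_apply S (aff_apply T x)"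
proof
  \<comment> \<open>The pair of the composite map, which differs from \<open>aff_mult S T\<close> by
    the summand \<open>snd S\<close>.\<close>
  show "(fst S ** fst T, fst S *v snd T + snd S) \<in> Aff"
    using assms by (simp add: Aff_def invertible_mult)
qed (simp add: aff_apply_def matrix_vector_right_distrib matrix_vector_mul_assoc add.assoc)

lemma Aff_inverse:
  assumes "T \<in> Aff"
  obtains R where "R \<in> Aff" "\<And>x. aff_apply R (aff_apply T x) = x"
proof -
  obtain B where B: "B ** fst T = mat 1" "fst T ** B = mat 1"
    using assms by (auto simp: Aff_def invertible_def)
  show thesis
  proof
    show "(B, - (B *v snd T)) \<in> Aff"
      using B by (auto simp: Aff_def invertible_def)
  qed (simp add: aff_apply_def matrix_vector_right_distrib matrix_vector_mul_assoc B)
qed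

section \<open>Affine relatedness of germs\<close>

lemma aff_related_at_sym:
  assumes "aff_related_at M x f g" shows "aff_related_at M x g f"
proof -
  obtain W T where W: "openin (top_of_set M) W" "x \<in> W" "\<forall>y\<in>W. g y = aff_apply T (f y)"
    and T: "T \<in> Aff"
    using assms by (auto simp: aff_related_at_def)
  obtain R where "R \<in> Aff" "\<And>x. aff_apply R (aff_apply T x) = x"
    using Aff_inverse[OF T] by blast
  moreover from this have "\<forall>y\<in>W. f y = aff_apply R (g y)"
    using W(3) by simp
  ultimately show ?thesis
    using W unfolding aff_related_at_def by blast
qed

lemma aff_related_at_trans:
  assumes "aff_related_at M x f g" "aff_related_at M x g h"
  shows "aff_related_at M x f h"
proof -
  obtain W S where W: "openin (top_of_set M) W" "x \<in> W" "\<forall>y\<in>W. g y = aff_apply S (f y)"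
    and S: "S \<in> Aff"
    using assms(1) by (auto simp: aff_related_at_def)
  obtain V T where V: "openin (top_of_set M) V" "x \<in> V" "\<forall>y\<in>V. h y = aff_apply T (g y)"
    and T: "T \<in> Aff"
    using assms(2) by (auto simp: aff_related_at_def)
  obtain R where R: "R \<in> Aff" "\<And>x. aff_apply R x = aff_apply T (aff_apply S x)"
    using Aff_compose[OF T S] by blast
  have "openin (top_of_set M) (W \<inter> V)" "x \<in> W \<inter> V"
    "\<forall>y\<in>W \<inter> V. h y = aff_apply R (f y)"
    using W V R by auto
  then show ?thesis
    using R(1) unfolding aff_related_at_def by blast
qed

text \<open>Substitution along a continuous map. It is used with the covering \<open>p\<close> to
  lift coordinate changes of \<open>M\<close>, and with an affine diffeomorphism \<open>g\<close> to
  move germs of \<open>D\<close> from \<open>g x\<close> to \<open>x\<close>.\<close>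

lemma aff_related_at_compose:
  assumes rel: "aff_related_at N (q x) f g" and q: "continuous_on M q" "q ` M \<subseteq> N" and "x \<in> M"
  shows "aff_related_at M x (\<lambda>y. f (q y)) (\<lambda>y. g (q y))"
proof -
  obtain W T where W: "openin (top_of_set N) W" "q x \<in> W" "\<forall>y\<in>W. g y = aff_apply T (f y)"
    and T: "T \<in> Aff"
    using rel by (auto simp: aff_related_at_def)
  have "openin (top_of_set M) (M \<inter> q -` W)"
    using q W(1) by (intro continuous_openin_preimage) auto
  then show ?thesis
    using W T \<open>x \<in> M\<close> unfolding aff_related_at_def
    by (intro exI[of _ "M \<inter> q -` W"]) auto
qed

text \<open>Continuation along a connected set: \<open>img\<close> makes the local affine map unique
  at each point, so it is locally constant, hence constant.\<close>

lemma aff_related_on_connected: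
  fixes f g :: "'m::topological_space \<Rightarrow> real^'n::finite"
  assumes "connected M"
    and img: "\<And>V. openin (top_of_set M) V \<Longrightarrow> V \<noteq> {} \<Longrightarrow> \<exists>Q. open Q \<and> Q \<noteq> {} \<and> Q \<subseteq> f ` V"
    and rel: "\<And>x. x \<in> M \<Longrightarrow> aff_related_at M x f g"
  shows "\<exists>T\<in>Aff. \<forall>x\<in>M. g x = aff_apply T (f x)"
proof (cases "M = {}")
  case True
  have "(mat 1, 0) \<in> Aff" by (auto simp: Aff_def invertible_def)
  with True show ?thesis by blast
next
  case False
  have uniq: "S = T"
    if "openin (top_of_set M) V" "x \<in> V" "\<forall>y\<in>V. g y = aff_apply S (f y)"
      "openin (top_of_set M) W" "x \<in> W" "\<forall>y\<in>W. g y = aff_apply T (f y)" for V W S T x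
  proof -
    \<comment> \<open>On the common neighbourhood both maps give \<open>g\<close>, so they agree on
      an open set of values of \<open>f\<close>.\<close>
    have "openin (top_of_set M) (V \<inter> W)" "V \<inter> W \<noteq> {}"
      using that by auto
    then obtain Q where "open Q" "Q \<noteq> {}" "Q \<subseteq> f ` (V \<inter> W)"
      using img by blast
    moreover have "aff_apply S q = aff_apply T q" if "q \<in> f ` (V \<inter> W)" for q
      using that \<open>\<forall>y\<in>V. _ y\<close> \<open>\<forall>y\<in>W. _ y\<close> by force
    ultimately show ?thesis
      using aff_apply_inject_open by (metis subsetD)
  qed
  define P where "P = (\<lambda>x T. T \<in> Aff \<and> (\<exists>W. openin (top_of_set M) W \<and> x \<in> W \<and>
    (\<forall>y\<in>W. g y = aff_apply T (f y))))"
  \<comment> \<open>By \<open>uniq\<close> the selected map is the only one satisfying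
    \<open>P x\<close>, so neighbouring selections agree.\<close>
  define \<tau> where "\<tau> = (\<lambda>x. SOME T. P x T)"
  have \<tau>: "P x (\<tau> x)" if "x \<in> M" for x
    using rel[OF that] someI_ex[of "P x"] unfolding \<tau>_def P_def aff_related_at_def by blast
  have "\<tau> constant_on M"
  proof (rule locally_constant_imp_constant[OF \<open>connected M\<close>])
    fix x assume "x \<in> M"
    then obtain W where W: "openin (top_of_set M) W" "x \<in> W" "\<forall>y\<in>W. g y = aff_apply (\<tau> x) (f y)"
      using \<tau> unfolding P_def by blast
    have "\<tau> y = \<tau> x" if "y \<in> W" for y
    proof -
      have "y \<in> M" using W(1) that openin_imp_subset by blast
      then show ?thesis
        using \<tau>[of y] uniq[of _ y "\<tau> y" W "\<tau> x"] W that unfolding P_def by blast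
    qed
    with W show "\<exists>W. openin (top_of_set M) W \<and> x \<in> W \<and> (\<forall>y\<in>W. \<tau> y = \<tau> x)"
      by blast
  qed
  then obtain T where T: "\<And>x. x \<in> M \<Longrightarrow> \<tau> x = T"
    by (auto simp: constant_on_def)
  then have "T \<in> Aff" "\<forall>x\<in>M. g x = aff_apply T (f x)"
    using \<tau> False unfolding P_def by blast+
  then show ?thesis by blast
qed

section \<open>Connectedness and discrete fibres\<close>

text \<open>The library states this only for subsets of normed spaces.\<close>

lemma simply_connected_imp_connected_general:
  fixes S :: "'a::topological_space set"
  assumes "simply_connected S"
  shows "connected S"
proof (rule path_connected_imp_connected)
  show "path_connected S"
    unfolding path_connected_component
  proof (intro ballI)
    fix a b assume "a \<in> S" "b \<in> S"
    then have "homotopic_loops S (\<lambda>_. a) (\<lambda>_. b)"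
      by (intro assms[unfolded simply_connected_def, rule_format])
        (auto simp: path_def path_image_def pathstart_def pathfinish_def)
    \<comment> \<open>The homotopy between the two constant loops, followed at loop parameter 0, is
      a path from \<open>a\<close> to \<open>b\<close>.\<close>
    from homotopic_loops_imp_path_component_value[OF this, of 0]
    show "path_component S a b" by simp
  qed
qed

text \<open>Fibres of a covering are discrete, because \<open>p\<close> is injective on a small
  sheet. This is the form in which the discreteness of the deck group enters.\<close>

lemma continuous_into_fibre_constant:
  assumes cov: "covering_space C p M" and "connected T"
    and f: "continuous_on T f" "f ` T \<subseteq> C" and fib: "\<And>t. t \<in> T \<Longrightarrow> p (f t) = y"
  shows "f constant_on T"
proof (rule locally_constant_imp_constant[OF \<open>connected T\<close>])
  fix a assume a: "a \<in> T"
  then have "f a \<in> C" using f by blast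
  then obtain V u q where V: "f a \<in> V" "openin (top_of_set C) V" "homeomorphism V u p q"
    using covering_space_local_homeomorphism[OF cov] by metis
  have "f t = f a" if "t \<in> T" "f t \<in> V" for t
    using fib[OF that(1)] fib[OF a] V that by (metis homeomorphism_apply1)
  moreover have "openin (top_of_set T) (T \<inter> f -` V)"
    using f V(2) by (intro continuous_openin_preimage) auto
  ultimately show "\<exists>W. openin (top_of_set T) W \<and> a \<in> W \<and> (\<forall>t\<in>W. f t = f a)"
    using a V(1) by blast
qed

section \<open>Developing map and holonomy\<close>

text \<open>Cutting \<open>V\<close> down by a neighbourhood on which \<open>p\<close> is a
  homeomorphism yields exactly the conditions that \<open>pullback_atlas\<close> puts on a chart
  domain.\<close>

lemma covering_space_open_imageE:
  assumes cov: "covering_space C p M" and V: "openin (top_of_set C) V" and "x \<in> V"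
  obtains W where "openin (top_of_set C) W" "x \<in> W" "W \<subseteq> V" "openin (top_of_set M) (p ` W)"
    "\<exists>q. homeomorphism W (p ` W) p q"
proof -
  have "x \<in> C" using V \<open>x \<in> V\<close> openin_imp_subset by blast
  then obtain T u q where T: "x \<in> T" "openin (top_of_set C) T" "openin (top_of_set M) u"
    and hom: "homeomorphism T u p q"
    using covering_space_local_homeomorphism[OF cov] by metis
  have "openin (top_of_set T) (T \<inter> V)"
    using V T(2) by (meson Int_lower1 openin_Int openin_imp_subset openin_subset_trans)
  then have "openin (top_of_set u) (p ` (T \<inter> V))"
    by (rule homeomorphism_imp_open_map[OF hom])
  then have "openin (top_of_set M) (p ` (T \<inter> V))"
    using T(3) openin_trans by blast
  moreover have "homeomorphism (T \<inter> V) (p ` (T \<inter> V)) p q"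
    using hom by (rule homeomorphism_of_subsets) (use hom in \<open>auto simp: homeomorphism_def\<close>)
  ultimately show thesis
    using that[of "T \<inter> V"] T V \<open>x \<in> V\<close> by blast
qed

lemma has_chart_pullback:
  assumes M: "affine_manifold M \<A>" and cov: "covering_space C p M" and "x \<in> C"
  obtains W U \<phi> where "(W, \<phi> \<circ> p) \<in> pullback_atlas C p M \<A>" "x \<in> W" "(U, \<phi>) \<in> \<A>" "p ` W \<subseteq> U"
    "openin (top_of_set C) W"
proof -
  have p: "continuous_on C p" "p ` C = M"
    using cov by (auto simp: covering_space_def)
  then have "p x \<in> M" using \<open>x \<in> C\<close> by blast
  then obtain U \<phi> where U: "(U, \<phi>) \<in> \<A>" "p x \<in> U"
    using M unfolding affine_manifold_def by blast
  then have "openin (top_of_set M) U"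
    using M unfolding affine_manifold_def by blast
  then have "openin (top_of_set C) (C \<inter> p -` U)"
    using p by (intro continuous_openin_preimage) auto
  then obtain W where "openin (top_of_set C) W" "x \<in> W" "W \<subseteq> C \<inter> p -` U"
    "openin (top_of_set M) (p ` W)" "\<exists>q. homeomorphism W (p ` W) p q"
    by (rule covering_space_open_imageE[OF cov, of _ x]) (use U \<open>x \<in> C\<close> in auto)
  then show thesis
    using U by (intro that[of W \<phi> U]) (auto simp: pullback_atlas_def)
qed

text \<open>Near a point, \<open>D\<close> is an invertible affine map after a chart after
  \<open>p\<close>, and each of the three is open on small sets. The conclusion has the shape of the
  hypothesis \<open>img\<close> of \<open>aff_related_on_connected\<close>.\<close>

lemma developing_map_open_image:
  fixes D :: "'c::topological_space \<Rightarrow> real^'n::finite"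
  assumes M: "affine_manifold M \<A>" and cov: "covering_space C p M"
    and D: "developing_map C (pullback_atlas C p M \<A>) D"
    and V: "openin (top_of_set C) V" "V \<noteq> {}"
  shows "\<exists>Q. open Q \<and> Q \<noteq> {} \<and> Q \<subseteq> D ` V"
proof -
  obtain x where x: "x \<in> V" using V by blast
  then have "x \<in> C" using V(1) openin_imp_subset by blast
  then obtain W U \<phi> where W: "(W, \<phi> \<circ> p) \<in> pullback_atlas C p M \<A>" "x \<in> W" "(U, \<phi>) \<in> \<A>"
    "p ` W \<subseteq> U" "openin (top_of_set C) W"
    using has_chart_pullback[OF M cov] by metis
  have "aff_related_at C x (\<phi> \<circ> p) D"
    using D W(1,2) \<open>x \<in> C\<close> by (force simp: developing_map_def affine_local_diffeo_def)
  then obtain Z T where Z: "openin (top_of_set C) Z" "x \<in> Z"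
      "\<forall>y\<in>Z. D y = aff_apply T ((\<phi> \<circ> p) y)" and T: "T \<in> Aff"
    by (auto simp: aff_related_at_def)
  have "openin (top_of_set C) (V \<inter> W \<inter> Z)" "x \<in> V \<inter> W \<inter> Z"
    using V W Z x by auto
  then obtain Y where Y: "x \<in> Y" "Y \<subseteq> V \<inter> W \<inter> Z" "openin (top_of_set M) (p ` Y)"
    using covering_space_open_imageE[OF cov] by metis
  obtain \<psi> where U: "openin (top_of_set M) U" "open (\<phi> ` U)" "homeomorphism U (\<phi> ` U) \<phi> \<psi>"
    using M W(3) unfolding affine_manifold_def by blast
  have "openin (top_of_set U) (p ` Y)"
    using Y W U by (meson openin_subset_trans openin_imp_subset image_mono order_trans le_infE)
  then have "open (\<phi> ` p ` Y)"
    using homeomorphism_imp_open_map[OF U(3)] U(2) by (metis openin_open_trans)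
  moreover have "surj ((*v) (fst T))"
    using T by (simp add: Aff_def invertible_eq_bij bij_is_surj)
  ultimately have "open ((*v) (fst T) ` \<phi> ` p ` Y)"
    by (intro open_surjective_linear_image) auto
  then have "open ((+) (snd T) ` (*v) (fst T) ` \<phi> ` p ` Y)"
    by (rule open_translation)
  moreover have "D y = snd T + fst T *v \<phi> (p y)" if "y \<in> Y" for y
    using Y(2) Z(3) that by (auto simp: aff_apply_def add.commute)
  then have "D ` Y = (+) (snd T) ` (*v) (fst T) ` \<phi> ` p ` Y"
    by (simp add: image_image)
  ultimately have "open (D ` Y)" by simp
  moreover have "D ` Y \<noteq> {}" "D ` Y \<subseteq> D ` V"
    using Y by auto
  ultimately show ?thesis by blast
qed

section \<open>The representation \<open>H_M\<close> and the deck group\<close>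

locale developed_cover =
  fixes M :: "'m::topological_space set" and \<A> :: "('m, 'n::finite) atlas"
    and C :: "'c::topological_space set" and p :: "'c \<Rightarrow> 'm" and D :: "'c \<Rightarrow> real^'n"
  assumes manifold: "affine_manifold M \<A>"
    and cover: "universal_cover C p M"
    and develop: "developing_map C (pullback_atlas C p M \<A>) D"
begin

abbreviation "\<A>C \<equiv> pullback_atlas C p M \<A>"

lemma covering: "covering_space C p M" and connected_C: "connected C"
  using cover simply_connected_imp_connected_general by (auto simp: universal_cover_def)

lemma continuous_p: "continuous_on C p" and image_p: "p ` C = M"
  using covering by (auto simp: covering_space_def)

lemma C_nonempty: "C \<noteq> {}"
  using image_p manifold by (auto simp: affine_manifold_def)

lemma D_open_image:
  assumes "openin (top_of_set C) V" "V \<noteq> {}"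
  shows "\<exists>Q. open Q \<and> Q \<noteq> {} \<and> Q \<subseteq> D ` V"
  using developing_map_open_image[OF manifold covering develop assms] .

text \<open>The image of \<open>D\<close> contains a nonempty open set, which determines an affine
  map.\<close>

lemma Aff_eqI:
  assumes "\<And>x. x \<in> C \<Longrightarrow> aff_apply S (D x) = aff_apply T (D x)"
  shows "S = T"
proof -
  obtain Q where "open Q" "Q \<noteq> {}" "Q \<subseteq> D ` C"
    using D_open_image[of C] C_nonempty by auto
  then show ?thesis
    using assms by (intro aff_apply_inject_open[of Q]) auto
qed

text \<open>Existence of \<open>H_M(g)\<close>: \<open>D\<close> and \<open>D\<close> after
  \<open>g\<close> are affinely related at every point through charts at \<open>x\<close> and
  \<open>g x\<close>, and \<open>C\<close> is connected.\<close>

lemma affine_diffeo_equivariant: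
  assumes "g \<in> affine_diffeos C \<A>C"
  shows "\<exists>T\<in>Aff. \<forall>x\<in>C. D (g x) = aff_apply T (D x)"
proof (rule aff_related_on_connected[OF connected_C D_open_image])
  fix x assume x: "x \<in> C"
  have g: "affine_local_diffeo C \<A>C C \<A>C g" "continuous_on C g" "g ` C \<subseteq> C"
    using assms by (auto simp: affine_diffeos_def affine_local_diffeo_def)
  then have gx: "g x \<in> C" using x by blast
  obtain W \<phi> where W: "(W, \<phi>) \<in> \<A>C" "x \<in> W"
    using has_chart_pullback[OF manifold covering x] by metis
  obtain V \<psi> where V: "(V, \<psi>) \<in> \<A>C" "g x \<in> V"
    using has_chart_pullback[OF manifold covering gx] by metis
  have D: "aff_related_at C y \<eta> D" if "(Z, \<eta>) \<in> \<A>C" "y \<in> Z" "y \<in> C" for Z \<eta> y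
    using develop that by (force simp: developing_map_def affine_local_diffeo_def)
  have "aff_related_at C x D \<phi>"
    using D[OF W x] by (rule aff_related_at_sym)
  moreover have "aff_related_at C x \<phi> (\<lambda>y. \<psi> (g y))"
    using g(1) W V x unfolding affine_local_diffeo_def by blast
  moreover have "aff_related_at C x (\<lambda>y. \<psi> (g y)) (\<lambda>y. D (g y))"
    using aff_related_at_compose[OF D[OF V gx] g(2,3) x] .
  ultimately show "aff_related_at C x D (\<lambda>y. D (g y))"
    using aff_related_at_trans by blast
qed

text \<open>Existence together with \<open>Aff_eqI\<close> makes the definite description in
  \<open>aff_rep\<close> well defined.\<close>

lemma aff_rep:
  assumes "g \<in> affine_diffeos C \<A>C"
  shows aff_rep_in_Aff: "aff_rep C D g \<in> Aff"
    and aff_rep_apply: "x \<in> C \<Longrightarrow> aff_apply (aff_rep C D g) (D x) = D (g x)"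
proof -
  have "\<exists>!T. T \<in> Aff \<and> (\<forall>x\<in>C. D (g x) = aff_apply T (D x))"
    using affine_diffeo_equivariant[OF assms] by (metis Aff_eqI)
  from theI'[OF this]
  show "aff_rep C D g \<in> Aff" "x \<in> C \<Longrightarrow> aff_apply (aff_rep C D g) (D x) = D (g x)"
    by (auto simp: aff_rep_def)
qed

text \<open>Charts of the cover factor through \<open>p\<close>, and \<open>p\<close> absorbs a deck
  transformation, so only a coordinate change of \<open>M\<close> at the one point
  \<open>p x\<close> remains.\<close>

lemma deck_subset_affine_diffeos: "deck_transformations C p \<subseteq> affine_diffeos C \<A>C"
proof
  fix g assume "g \<in> deck_transformations C p"
  then have g: "g \<in> Bij C" "\<exists>h. homeomorphism C C g h" and pg: "\<And>x. x \<in> C \<Longrightarrow> p (g x) = p x"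
    by (auto simp: deck_transformations_def)
  then have cont: "continuous_on C g" "g ` C \<subseteq> C"
    by (auto simp: homeomorphism_def)
  have "aff_related_at C x \<eta> (\<lambda>y. \<omega> (g y))"
    if W: "(W, \<eta>) \<in> \<A>C" and V: "(V, \<omega>) \<in> \<A>C" and x: "x \<in> C" "x \<in> W" "g x \<in> V" for W \<eta> V \<omega> x
  proof -
    obtain U \<phi> where U: "\<eta> = \<phi> \<circ> p" "(U, \<phi>) \<in> \<A>" "p x \<in> U"
      using W x by (auto simp: pullback_atlas_def)
    obtain U' \<phi>' where U': "\<omega> = \<phi>' \<circ> p" "(U', \<phi>') \<in> \<A>" "p (g x) \<in> U'"
      using V x by (auto simp: pullback_atlas_def)
    have "aff_related_at M (p x) \<phi> \<phi>'"
      using manifold U(2,3) U'(2,3) unfolding affine_manifold_def pg[OF x(1)] by blast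
    then have "aff_related_at C x (\<lambda>y. \<phi> (p y)) (\<lambda>y. \<phi>' (p y))"
      using continuous_p image_p x(1) by (intro aff_related_at_compose[of M p]) blast+
    then obtain Z T where Z: "openin (top_of_set C) Z" "x \<in> Z" "T \<in> Aff"
      "\<forall>y\<in>Z. \<phi>' (p y) = aff_apply T (\<phi> (p y))"
      by (auto simp: aff_related_at_def)
    moreover have "\<forall>y\<in>Z. \<omega> (g y) = aff_apply T (\<eta> y)"
      using Z(1,4) pg U(1) U'(1) openin_imp_subset by fastforce
    ultimately show ?thesis
      unfolding aff_related_at_def by blast
  qed
  then show "g \<in> affine_diffeos C \<A>C"
    using g cont by (auto simp: affine_diffeos_def affine_local_diffeo_def)
qed

subsection \<open>One-parameter subgroups of the normalizer\<close>

lemma lie_algebra_apply: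
  assumes "\<theta> \<in> lie_algebra C G" "G \<subseteq> Bij C"
  shows "\<theta> t \<in> G" and "\<theta> t ` C = C" and "x \<in> C \<Longrightarrow> \<theta> (s + t) x = \<theta> s (\<theta> t x)"
    and "x \<in> C \<Longrightarrow> \<theta> 0 x = x"
proof -
  have mem: "\<theta> t \<in> G" for t
    using assms by (auto simp: lie_algebra_def)
  then show "\<theta> t \<in> G" .
  have bij: "\<theta> t \<in> Bij C" for t
    using mem assms(2) by blast
  then show "\<theta> t ` C = C"
    by (auto simp: Bij_def bij_betw_def)
  show add: "\<theta> (s + t) x = \<theta> s (\<theta> t x)" if "x \<in> C" for s t x
    using assms(1) bij that by (simp add: lie_algebra_def BijGroup_def compose_def)
  show "\<theta> 0 x = x" if "x \<in> C"
  proof -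
    \<comment> \<open>\<open>\<theta> 0\<close> is idempotent by additivity and injective, hence the
      identity on \<open>C\<close>.\<close>
    have "\<theta> 0 x \<in> C" "\<theta> 0 (\<theta> 0 x) = \<theta> 0 x" "inj_on (\<theta> 0) C"
      using bij[of 0] that add[OF that, of 0 0] by (auto simp: Bij_def bij_betw_def)
    then show ?thesis
      using that by (auto dest: inj_onD)
  qed
qed

text \<open>\<open>normalizer\<close> is phrased with the inverse of \<open>affine_group\<close>.
  The definition of \<open>m_inv\<close> is unfolded, and uniqueness is inherited from the larger
  group \<open>BijGroup C\<close>.\<close>

lemma lie_algebra_inverse:
  assumes "\<theta> \<in> lie_algebra C G" "G \<subseteq> affine_diffeos C \<A>C"
  shows "inv\<^bsub>affine_group C \<A>C\<^esub> (\<theta> t) = \<theta> (- t)"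
proof -
  have GB: "G \<subseteq> Bij C"
    using assms(2) by (auto simp: affine_diffeos_def)
  note \<theta> = lie_algebra_apply[OF assms(1) GB]
  have B: "\<theta> s \<in> Bij C" for s using \<theta>(1) GB by blast
  have one: "\<theta> 0 = (\<lambda>x\<in>C. x)"
    using B[of 0] \<theta>(4) by (intro extensionalityI[of _ C]) (auto simp: Bij_def)
  have mult: "\<theta> s \<otimes>\<^bsub>BijGroup C\<^esub> \<theta> u = \<theta> (s + u)" for s u
    using assms(1) by (simp add: lie_algebra_def)
  interpret B: group "BijGroup C" by (rule group_BijGroup)
  show ?thesis
    unfolding m_inv_def
  proof (rule the_equality)
    show "\<theta> (- t) \<in> carrier (affine_group C \<A>C) \<and>
      \<theta> t \<otimes>\<^bsub>affine_group C \<A>C\<^esub> \<theta> (- t) = \<one>\<^bsub>affine_group C \<A>C\<^esub> \<and>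
      \<theta> (- t) \<otimes>\<^bsub>affine_group C \<A>C\<^esub> \<theta> t = \<one>\<^bsub>affine_group C \<A>C\<^esub>"
      using \<theta>(1) assms(2) mult one by (auto simp: affine_group_def BijGroup_def)
    fix h assume "h \<in> carrier (affine_group C \<A>C) \<and>
      \<theta> t \<otimes>\<^bsub>affine_group C \<A>C\<^esub> h = \<one>\<^bsub>affine_group C \<A>C\<^esub> \<and>
      h \<otimes>\<^bsub>affine_group C \<A>C\<^esub> \<theta> t = \<one>\<^bsub>affine_group C \<A>C\<^esub>"
    then have h: "h \<in> carrier (BijGroup C)" "\<theta> t \<otimes>\<^bsub>BijGroup C\<^esub> h = \<one>\<^bsub>BijGroup C\<^esub>"
      by (auto simp: affine_group_def affine_diffeos_def BijGroup_def)
    moreover have "\<theta> (- t) \<otimes>\<^bsub>BijGroup C\<^esub> \<theta> t = \<one>\<^bsub>BijGroup C\<^esub>"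
      using mult one by (simp add: BijGroup_def)
    ultimately show "h = \<theta> (- t)"
      using B[of t] B[of "- t"] B.inv_unique[of "\<theta> (- t)" "\<theta> t" h] by (simp add: BijGroup_def)
  qed
qed

text \<open>Conjugates of \<gamma> by \<open>\<theta> s\<close> are deck transformations, so the
  curve they trace from a point stays in one fibre. It is continuous, hence constant, and its values
  at 0 and \<open>t\<close> give the identity.\<close>

lemma normalizer_lie_algebra_commutes:
  defines "G \<equiv> normalizer (affine_group C \<A>C) (deck_transformations C p)"
  assumes \<theta>: "\<theta> \<in> lie_algebra C G" and \<gamma>: "\<gamma> \<in> deck_transformations C p" and y: "y \<in> C"
  shows "\<theta> t (\<gamma> y) = \<gamma> (\<theta> t y)"
proof -
  let ?A = "affine_group C \<A>C" and ?H = "deck_transformations C p"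
  have carrier: "carrier ?A = affine_diffeos C \<A>C"
    by (simp add: affine_group_def)
  have GA: "G \<subseteq> affine_diffeos C \<A>C"
    by (auto simp: G_def normalizer_def stabilizer_def carrier)
  then have GB: "G \<subseteq> Bij C"
    by (auto simp: affine_diffeos_def)
  note th = lie_algebra_apply[OF \<theta> GB]
  have \<gamma>B: "\<gamma> \<in> Bij C" and \<gamma>c: "continuous_on C \<gamma>" "\<gamma> ` C = C" and \<gamma>p: "\<And>x. x \<in> C \<Longrightarrow> p (\<gamma> x) = p x"
    using \<gamma> by (auto simp: deck_transformations_def homeomorphism_def)
  have B: "\<theta> s \<in> Bij C" for s using th(1) GB by blast
  have "\<theta> s \<otimes>\<^bsub>BijGroup C\<^esub> \<gamma> \<otimes>\<^bsub>BijGroup C\<^esub> \<theta> (- s) \<in> ?H" for s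
  proof -
    \<comment> \<open>The conjugation action behind \<open>normalizer\<close> is restricted to
      subsets of the carrier, hence the appeal to \<open>deck_subset_affine_diffeos\<close>.\<close>
    have "\<theta> s <#\<^bsub>?A\<^esub> ?H #>\<^bsub>?A\<^esub> inv\<^bsub>?A\<^esub> (\<theta> s) = ?H"
      using th(1)[of s] deck_subset_affine_diffeos
      by (auto simp: G_def normalizer_def stabilizer_def carrier)
    then have "\<theta> s \<otimes>\<^bsub>?A\<^esub> \<gamma> \<otimes>\<^bsub>?A\<^esub> \<theta> (- s) \<in> ?H"
      using \<gamma> unfolding lie_algebra_inverse[OF \<theta> GA] by (auto simp: l_coset_def r_coset_def)
    then show ?thesis by (simp add: affine_group_def)
  qed
  moreover have "(\<theta> s \<otimes>\<^bsub>BijGroup C\<^esub> \<gamma> \<otimes>\<^bsub>BijGroup C\<^esub> \<theta> (- s)) x = \<theta> s (\<gamma> (\<theta> (- s) x))"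
    if "x \<in> C" for s x
  proof -
    have "compose C (\<theta> s) \<gamma> \<in> Bij C"
      using B \<gamma>B by (rule compose_Bij)
    then show ?thesis
      using B \<gamma>B that th(2)[of "- s"] by (auto simp: BijGroup_def compose_def)
  qed
  ultimately have fib: "p (\<theta> s (\<gamma> (\<theta> (- s) x))) = p x" if "x \<in> C" for s x
    using that by (force simp: deck_transformations_def)
  \<comment> \<open>With this base point the curve \<open>f\<close> below has
    \<open>f t = \<theta> t (\<gamma> y)\<close> and
    \<open>f 0 = \<gamma> (\<theta> t y)\<close>.\<close>
  define x where "x = \<theta> t y"
  have x: "x \<in> C" using y th(2) by (auto simp: x_def)
  define f where "f = (\<lambda>s. \<theta> s (\<gamma> (\<theta> (- s) x)))"
  have \<theta>c: "continuous_on (UNIV \<times> C) (\<lambda>(t, x). \<theta> t x)"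
    using \<theta> by (simp add: lie_algebra_def)
  have in_C: "\<theta> s z \<in> C" "\<gamma> z \<in> C" if "z \<in> C" for s z
    using th(2) \<gamma>c(2) that by blast+
  have "continuous_on UNIV (\<lambda>s. \<theta> (- s) x)"
    using continuous_on_compose2[OF \<theta>c, of UNIV "\<lambda>s. (- s, x)"] x
    by (simp add: image_subset_iff continuous_on_Pair continuous_on_minus)
  then have "continuous_on UNIV (\<lambda>s. \<gamma> (\<theta> (- s) x))"
    by (rule continuous_on_compose2[OF \<gamma>c(1)]) (use in_C x in auto)
  then have "continuous_on UNIV (\<lambda>s. (s, \<gamma> (\<theta> (- s) x)))"
    by (intro continuous_intros)
  then have "continuous_on UNIV f"
    using continuous_on_compose2[OF \<theta>c, of UNIV "\<lambda>s. (s, \<gamma> (\<theta> (- s) x))"] in_C x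
    by (auto simp: f_def)
  moreover have "f ` UNIV \<subseteq> C"
    using in_C x by (auto simp: f_def)
  moreover have "p (f s) = p x" for s
    using fib[OF x] by (simp add: f_def)
  ultimately have "f constant_on (UNIV :: real set)"
    using continuous_into_fibre_constant[OF covering connected_UNIV] by blast
  then have "f t = f 0" by (auto simp: constant_on_def)
  moreover have "\<theta> (- t) x = y"
    using th(3)[OF y, of "- t" t] th(4)[OF y] by (simp add: x_def)
  ultimately show ?thesis
    using th(4) in_C x y by (simp add: f_def x_def)
qed

text \<open>The derivative at 0 of the commutation of \<open>H_M(\<theta> t)\<close> with the
  holonomy \<open>h\<close>: the vector field \<open>X\<close> is invariant under
  \<open>h\<close>.\<close>

lemma normalizer_lie_image_commutes:
  assumes X: "X \<in> normalizer_lie_image M \<A> C p D" and \<gamma>: "\<gamma> \<in> deck_transformations C p"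
  defines "h \<equiv> aff_rep C D \<gamma>"
  shows "aff_apply X (aff_apply h v) = fst h *v aff_apply X v"
proof -
  obtain \<theta> where \<theta>: "\<theta> \<in> lie_algebra C (normalizer (affine_group C \<A>C) (deck_transformations C p))"
    and dX: "((\<lambda>t. aff_rep C D (\<theta> t)) has_vector_derivative X) (at 0)"
    using X by (auto simp: normalizer_lie_image_def lie_rep_image_def)
  have G: "normalizer (affine_group C \<A>C) (deck_transformations C p) \<subseteq> affine_diffeos C \<A>C"
    by (auto simp: normalizer_def stabilizer_def affine_group_def)
  then have GB: "normalizer (affine_group C \<A>C) (deck_transformations C p) \<subseteq> Bij C"
    by (auto simp: affine_diffeos_def)
  note th = lie_algebra_apply[OF \<theta> GB]
  have \<theta>A: "\<theta> t \<in> affine_diffeos C \<A>C" for t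
    using th(1) G by blast
  have \<gamma>A: "\<gamma> \<in> affine_diffeos C \<A>C"
    using \<gamma> deck_subset_affine_diffeos by blast
  have \<gamma>C: "\<gamma> x \<in> C" if "x \<in> C" for x
    using \<gamma> that by (auto simp: deck_transformations_def homeomorphism_def)
  have comm: "aff_apply (aff_rep C D (\<theta> t)) (aff_apply h v) = aff_apply h (aff_apply (aff_rep C D (\<theta> t)) v)" for t
  proof -
    define T where "T = aff_rep C D (\<theta> t)"
    obtain R where R: "\<And>x. aff_apply R x = aff_apply T (aff_apply h x)"
      using Aff_compose aff_rep_in_Aff[OF \<theta>A] aff_rep_in_Aff[OF \<gamma>A] unfolding T_def h_def by metis
    obtain S where S: "\<And>x. aff_apply S x = aff_apply h (aff_apply T x)"
      using Aff_compose aff_rep_in_Aff[OF \<theta>A] aff_rep_in_Aff[OF \<gamma>A] unfolding T_def h_def by metis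
    \<comment> \<open>Commutation on \<open>C\<close> gives equality of the two composites only on
      the image of \<open>D\<close>, which suffices by \<open>Aff_eqI\<close>.\<close>
    have "R = S"
    proof (rule Aff_eqI)
      fix x assume x: "x \<in> C"
      have "aff_apply R (D x) = D (\<theta> t (\<gamma> x))"
        using x \<gamma>C by (simp add: R T_def h_def aff_rep_apply[OF \<theta>A] aff_rep_apply[OF \<gamma>A])
      also have "\<dots> = D (\<gamma> (\<theta> t x))"
        using normalizer_lie_algebra_commutes[OF \<theta> \<gamma> x] by simp
      also have "\<dots> = aff_apply S (D x)"
      proof -
        have "\<theta> t x \<in> C" using x th(2)[of t] by blast
        then show ?thesis
          using x by (simp add: S T_def h_def aff_rep_apply[OF \<theta>A] aff_rep_apply[OF \<gamma>A])
      qed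
      finally show "aff_apply R (D x) = aff_apply S (D x)" .
    qed
    then show ?thesis using R S T_def by metis
  qed
  \<comment> \<open>For fixed \<open>w\<close>, evaluation is linear in the pair \<open>T\<close>,
    so it may be interchanged with the derivative in \<open>t\<close>.\<close>
  have app: "bounded_linear (\<lambda>T :: 'n aff. aff_apply T w)" for w
    unfolding aff_apply_def
    by (intro linear_conv_bounded_linear[THEN iffD1] linearI)
       (simp_all add: matrix_vector_mult_add_rdistrib scaleR_add_right scaleR_matrix_vector_assoc algebra_simps)
  have mul: "bounded_linear ((*v) (fst h))"
    by (rule matrix_vector_mul_bounded_linear)
  have "((\<lambda>t. aff_apply (aff_rep C D (\<theta> t)) (aff_apply h v)) has_vector_derivative
      aff_apply X (aff_apply h v)) (at 0)"
    using bounded_linear.has_vector_derivative[OF app dX] .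
  then have "((\<lambda>t. fst h *v aff_apply (aff_rep C D (\<theta> t)) v + snd h) has_vector_derivative
      aff_apply X (aff_apply h v)) (at 0)"
    unfolding comm by (simp add: aff_apply_def)
  \<comment> \<open>The constant \<open>snd h\<close> disappears on differentiation, which is why
    only the linear part of \<open>h\<close> acts on the field.\<close>
  moreover have "((\<lambda>t. fst h *v aff_apply (aff_rep C D (\<theta> t)) v + snd h) has_vector_derivative
      fst h *v aff_apply X v) (at 0)"
    using bounded_linear.has_vector_derivative[OF mul bounded_linear.has_vector_derivative[OF app dX]]
    by (auto intro!: derivative_eq_intros)
  ultimately show ?thesis
    by (rule vector_derivative_unique_at)
qed

end

section \<open>Invariant planes\<close>

lemma subspace_kernel_matrix: "subspace {x. (B :: real^'n::finite^'m::finite) *v x = 0}"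
  by (simp add: subspace_def matrix_vector_right_distrib matrix_vector_mult_scaleR)

text \<open>The kernel is the orthogonal complement of the row space, whose dimension is the
  rank.\<close>

lemma dim_kernel_add_rank:
  fixes B :: "real^'n::finite^'m::finite"
  shows "dim {x. B *v x = 0} + rank B = CARD('n)"
proof -
  have "{x. B *v x = 0} = {y \<in> UNIV. \<forall>x\<in>span (rows B). orthogonal x y}"
  proof (intro equalityI subsetI)
    fix y assume "y \<in> {x. B *v x = 0}"
    then show "y \<in> {y \<in> UNIV. \<forall>x\<in>span (rows B). orthogonal x y}"
      using orthogonal_nullspace_rowspace[of B y] by (auto simp: orthogonal_commute)
  next
    fix y assume "y \<in> {y \<in> UNIV. \<forall>x\<in>span (rows B). orthogonal x y}"
    then have "row i B \<bullet> y = 0" for i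
      by (auto simp: orthogonal_def rows_def intro: span_base)
    then show "y \<in> {x. B *v x = 0}"
      by (simp add: vec_eq_iff matrix_vector_mul_component row_def)
  qed
  then show ?thesis
    using dim_subspace_orthogonal_to_vectors[of "span (rows B)" "UNIV :: (real^'n) set"]
    by (simp add: row_rank_def)
qed

lemma commuting_image_range:
  fixes L B :: "real^'n::finite^'n"
  assumes "invertible L" "L ** B = B ** L"
  shows "(*v) L ` range ((*v) B) = range ((*v) B)"
proof -
  have "surj ((*v) L)"
    using assms(1) by (simp add: invertible_eq_bij bij_is_surj)
  then have "range ((*v) B) = (*v) B ` range ((*v) L)"
    by simp
  also have "\<dots> = (*v) L ` range ((*v) B)"
    using assms(2) by (simp add: image_image matrix_vector_mul_assoc)
  finally show ?thesis by simp
qed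

text \<open>By commutation and injectivity of \<open>L\<close>, a vector lies in the kernel of
  \<open>B\<close> if and only if its image under \<open>L\<close> does; surjectivity of
  \<open>L\<close> then gives equality.\<close>

lemma commuting_image_kernel:
  fixes L B :: "real^'n::finite^'n"
  assumes "invertible L" "L ** B = B ** L"
  shows "(*v) L ` {x. B *v x = 0} = {x. B *v x = 0}"
proof -
  have L: "bij ((*v) L)"
    using assms(1) by (simp add: invertible_eq_bij)
  have "B *v (L *v x) = L *v (B *v x)" for x
    using assms(2) by (simp add: matrix_vector_mul_assoc)
  then have "B *v (L *v x) = 0 \<longleftrightarrow> B *v x = 0" for x
    using L by (metis bij_is_inj injD matrix_vector_mult_0_right)
  then show ?thesis
    using bij_is_surj[OF L] by (auto simp: image_iff) (metis surjD)
qed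

section \<open>From semisimplicity to an invariant affine field\<close>

text \<open>If all linear parts vanished, all products in \<open>S\<close> would vanish too, and
  \<open>S\<close> would be a nilpotent ideal of itself.\<close>

lemma semisimple_nonzero_linear_part:
  assumes S: "aff_semisimple S" "S \<noteq> {0}"
  obtains X where "X \<in> S" "fst X \<noteq> 0"
proof (rule ccontr)
  assume "\<not> thesis"
  then have "\<forall>X\<in>S. fst X = 0" using that by blast
  then have zero: "aff_mult x y = 0" if "x \<in> S" for x y
    using that by (simp add: aff_mult_def zero_prod_def)
  have sub: "subspace S"
    using S(1) by (simp add: aff_semisimple_def aff_subalgebra_def)
  have "aff_ideal S S"
    using zero sub by (simp add: aff_ideal_def subspace_0)
  moreover have "aff_nilpotent S"
    unfolding aff_nilpotent_def
    \<comment> \<open>The index 1 stands for products of two elements.\<close>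
    by (rule exI[of _ 1]) (auto simp: length_Suc_conv zero)
  ultimately show False
    using S unfolding aff_semisimple_def by blast
qed

lemma wedderburn_semisimple_subset:
  assumes "wedderburn_decomposition A S N"
  shows "S \<subseteq> A"
proof
  fix s assume s: "s \<in> S"
  have A: "A = {s + n | s n. s \<in> S \<and> n \<in> N}" and "S \<inter> N = {0}"
    using assms by (simp_all add: wedderburn_decomposition_def)
  then have "0 \<in> N" by blast
  with s have "s + 0 \<in> A" unfolding A by blast
  then show "s \<in> A" by simp
qed

text \<open>Invariance of the field forces its linear part to commute with the linear holonomy,
  which therefore preserves range and kernel; the holonomy itself permutes the zeros of the
  field.\<close>

lemma (in developed_cover) normalizer_field_invariants:
  assumes X: "X \<in> normalizer_lie_image M \<A> C p D"
  shows "rank (fst X) = CARD('n) \<Longrightarrow> radiant C p D"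
    and "holonomy_invariant C p D (range ((*v) (fst X)))"
    and "holonomy_invariant C p D {x. fst X *v x = 0}"
proof -
  have comm: "aff_apply X (aff_apply (aff_rep C D \<gamma>) v) = fst (aff_rep C D \<gamma>) *v aff_apply X v"
    if "\<gamma> \<in> deck_transformations C p" for \<gamma> v
    using normalizer_lie_image_commutes[OF X that] .
  have lin: "invertible (fst (aff_rep C D \<gamma>))"
    "fst (aff_rep C D \<gamma>) ** fst X = fst X ** fst (aff_rep C D \<gamma>)"
    if \<gamma>: "\<gamma> \<in> deck_transformations C p" for \<gamma>
  proof -
    show "invertible (fst (aff_rep C D \<gamma>))"
      using aff_rep_in_Aff \<gamma> deck_subset_affine_diffeos by (auto simp: Aff_def)
    show "fst (aff_rep C D \<gamma>) ** fst X = fst X ** fst (aff_rep C D \<gamma>)"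
      unfolding matrix_eq
    proof
      fix v
      show "(fst (aff_rep C D \<gamma>) ** fst X) *v v = (fst X ** fst (aff_rep C D \<gamma>)) *v v"
        \<comment> \<open>Subtracting the relation at 0 from the one at \<open>v\<close> removes the
          translation parts.\<close>
        using comm[OF \<gamma>, of v] comm[OF \<gamma>, of 0]
        by (simp add: aff_apply_def matrix_vector_right_distrib matrix_vector_mul_assoc add.assoc)
    qed
  qed
  show "holonomy_invariant C p D (range ((*v) (fst X)))"
    unfolding holonomy_invariant_def using commuting_image_range[OF lin] by blast
  show "holonomy_invariant C p D {x. fst X *v x = 0}"
    unfolding holonomy_invariant_def using commuting_image_kernel[OF lin] by blast
  assume full: "rank (fst X) = CARD('n)"
  then have inj: "inj ((*v) (fst X))" and "surj ((*v) (fst X))"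
    using full_rank_injective full_rank_surjective by blast+
  then obtain v where v: "fst X *v v = - snd X"
    by (metis surjD)
  have "aff_apply (aff_rep C D \<gamma>) v = v" if "\<gamma> \<in> deck_transformations C p" for \<gamma>
  proof -
    \<comment> \<open>The image of the zero \<open>v\<close> under the holonomy is again a zero of
      \<open>X\<close>, and injectivity leaves only one.\<close>
    have "fst X *v aff_apply (aff_rep C D \<gamma>) v = - snd X"
      using comm[OF that, of v] v by (simp add: aff_apply_def[of X] add_eq_0_iff2)
    then show ?thesis
      using inj v by (metis injD)
  qed
  then show "radiant C p D"
    unfolding radiant_def by blast
qed

theorem proposition3p3:
  fixes M :: "'m::topological_space set" and \<A> :: "('m, 3) atlas"
    and C :: "'c::topological_space set" and p :: "'c \<Rightarrow> 'm" and D :: "'c \<Rightarrow> real^3"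
    and S\<^sub>M N\<^sub>M :: "3 aff set"
  assumes "affine_manifold M \<A>"
    and "compact M"
    and "universal_cover C p M"
    and "developing_map C (pullback_atlas C p M \<A>) D"
    and "wedderburn_decomposition (normalizer_lie_image M \<A> C p D) S\<^sub>M N\<^sub>M"
    and "S\<^sub>M \<noteq> {0}"
  shows "radiant C p D \<or> (\<exists>\<F>. linear_foliation C p D 1 \<F>)"
proof -
  interpret developed_cover M \<A> C p D
    using assms(1,3,4) by unfold_locales
  have "aff_semisimple S\<^sub>M"
    using assms(5) by (simp add: wedderburn_decomposition_def)
  then obtain X where X: "X \<in> S\<^sub>M" "fst X \<noteq> 0"
    using semisimple_nonzero_linear_part assms(6) by blast
  then have "X \<in> normalizer_lie_image M \<A> C p D"
    using wedderburn_semisimple_subset[OF assms(5)] by blast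
  note field = normalizer_field_invariants[OF this]
  have "rank (fst X) \<le> 3"
    using rank_bound[of "fst X"] by simp
  moreover have "rank (fst X) \<noteq> 0"
    using X(2) by (simp add: rank_eq_0)
  ultimately consider "rank (fst X) = 3" | "rank (fst X) = 2" | "rank (fst X) = 1"
    by linarith
  then show ?thesis
  proof cases
    case 1
    then show ?thesis using field(1) by simp
  next
    \<comment> \<open>The range is the invariant plane.\<close>
    case 2
    have "subspace (range ((*v) (fst X)))"
      by (simp add: linear_subspace_image)
    moreover have "dim (range ((*v) (fst X))) + 1 = CARD(3)"
      using 2 by (simp add: rank_dim_range)
    ultimately show ?thesis
      unfolding linear_foliation_def using field(2) by blast
  next
    \<comment> \<open>The range is a line, so the plane is now the kernel.\<close>
    case 3
    have "dim {x. fst X *v x = 0} + 1 = CARD(3)"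
      using dim_kernel_add_rank[of "fst X"] 3 by simp
    then show ?thesis
      unfolding linear_foliation_def using field(3) subspace_kernel_matrix by blast
  qed
qed

end
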